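(* Every Hausdorff topology $\tau$ on the extended bicyclic semigroup $\mathscr{C}_{\mathbb{Z}}$ such that $(\mathscr{C}_{\mathbb{Z}},\tau)$ is a semitopological semigroup is discrete. Hence $\mathscr{C}_{\mathbb{Z}}$ is a discrete subspace of any semitopological semigroup which contains $\mathscr{C}_{\mathbb{Z}}$ as a subsemigroup.
   Context: The extended bicyclic semigroup $\mathscr{C}_{\mathbb{Z}}$ is the set $\mathbb{Z}\times\mathbb{Z}$ with the operation $(a,b)\cdot(c,d)=(a-b+c,d)$ if $b<c$; $(a,b)\cdot(c,d)=(a,d)$ if $b=c$; $(a,b)\cdot(c,d)=(a,d+b-c)$ if $b>c$. A semitopological semigroup is a Hausdorff topological space together with a separately continuous semigroup operation. *)

theory Defs
  imports "HOL-Analysis.Analysis"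
begin

fun ext_bicyclic_mult :: "int \<times> int \<Rightarrow> int \<times> int \<Rightarrow> int \<times> int" where
  "ext_bicyclic_mult (a, b) (c, d) =
     (if b < c then (a - b + c, d)
      else if b = c then (a, d)
      else (a, d + b - c))"

definition semigroup_on :: "'a set \<Rightarrow> ('a \<Rightarrow> 'a \<Rightarrow> 'a) \<Rightarrow> bool" where
  "semigroup_on S m \<longleftrightarrow>
     (\<forall>x\<in>S. \<forall>y\<in>S. m x y \<in> S) \<and>
     (\<forall>x\<in>S. \<forall>y\<in>S. \<forall>z\<in>S. m (m x y) z = m x (m y z))"

lemma semigroup_on_ext_bicyclic: "semigroup_on UNIV ext_bicyclic_mult"
  by (auto simp: semigroup_on_def)

text \<open>The semigroup is carried by the underlying set of the topology; the values of \<open>m\<close>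
  outside it are irrelevant.\<close>

definition semitopological_semigroup :: "'a topology \<Rightarrow> ('a \<Rightarrow> 'a \<Rightarrow> 'a) \<Rightarrow> bool" where
  "semitopological_semigroup T m \<longleftrightarrow>
     Hausdorff_space T \<and>
     semigroup_on (topspace T) m \<and>
     (\<forall>a\<in>topspace T. continuous_map T T (\<lambda>x. m a x)) \<and>
     (\<forall>a\<in>topspace T. continuous_map T T (\<lambda>x. m x a))"

text \<open>Containment as a subsemigroup is up to isomorphism: \<open>h\<close> identifies the extended
  bicyclic semigroup with the subsemigroup \<open>range h\<close> of the semigroup \<open>(S, m)\<close>.\<close>

definition ext_bicyclic_embedding ::
    "'a set \<Rightarrow> ('a \<Rightarrow> 'a \<Rightarrow> 'a) \<Rightarrow> (int \<times> int \<Rightarrow> 'a) \<Rightarrow> bool" where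
  "ext_bicyclic_embedding S m h \<longleftrightarrow>
     range h \<subseteq> S \<and> inj h \<and>
     (\<forall>x y. h (ext_bicyclic_mult x y) = m (h x) (h y))"

end

theory Submission
  imports Defs
begin

text \<open>Multiplication by the idempotents \<open>(k, k)\<close> from either side is a retraction, so in a
  Hausdorff topology the half-planes \<open>fst x < k\<close> and \<open>snd x < k\<close> are open. Pulling them back along
  these retractions shows that the descending diagonal ray \<open>{(a - n, b - n) | n \<ge> 0}\<close> is
  open. Left multiplication by \<open>(a - 1, a - 1)\<close> fixes \<open>(a, b)\<close> and sends the rest of the ray to
  \<open>(a - 1, b - 1)\<close>, so \<open>(a, b)\<close> is isolated. A containing semigroup is handled by pulling its
  topology back along the embedding.\<close>

lemma semitopological_semigroupD:
  assumes "semitopological_semigroup T m"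
  shows "Hausdorff_space T"
    and "a \<in> topspace T \<Longrightarrow> continuous_map T T (m a)"
    and "a \<in> topspace T \<Longrightarrow> continuous_map T T (\<lambda>x. m x a)"
  using assms by (auto simp: semitopological_semigroup_def)

text \<open>Used with a translation for \<open>f\<close> and the identity for \<open>g\<close>: the
  points moved by the translation form an open set.\<close>

lemma openin_noteq_continuous_maps:
  assumes "Hausdorff_space Y" "continuous_map X Y f" "continuous_map X Y g"
  shows "openin X {x \<in> topspace X. f x \<noteq> g x}"
proof -
  have "{x \<in> topspace X. f x \<noteq> g x} = topspace X - {x \<in> topspace X. f x = g x}"
    by blast
  then show ?thesis
    using openin_diff[OF openin_topspace closedin_continuous_maps_eq[OF assms]] by (simp only:)
qed

lemma ext_bicyclic_openin_singleton:
  fixes \<tau> :: "(int \<times> int) topology"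
  assumes top: "topspace \<tau> = UNIV"
    and semi: "semitopological_semigroup \<tau> ext_bicyclic_mult"
  shows "openin \<tau> {(a, b)}"
proof -
  note haus = semitopological_semigroupD(1)[OF semi]
  have contL: "continuous_map \<tau> \<tau> (ext_bicyclic_mult p)"
    and contR: "continuous_map \<tau> \<tau> (\<lambda>x. ext_bicyclic_mult x p)" for p
    using semitopological_semigroupD(2,3)[OF semi] top by auto
  have contI: "continuous_map \<tau> \<tau> (\<lambda>x. x)"
    by simp
  have fst_less: "openin \<tau> {x. fst x < k}" for k
  proof -
    \<comment> \<open>Left translation by \<open>(k, k)\<close> raises a first coordinate below
      \<open>k\<close> to \<open>k\<close> and fixes every other point.\<close>
    have "{x. fst x < k} = {x \<in> topspace \<tau>. ext_bicyclic_mult (k, k) x \<noteq> x}"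
      by (auto simp: top split: if_splits)
    then show ?thesis
      using openin_noteq_continuous_maps[OF haus contL contI] by simp
  qed
  have snd_less: "openin \<tau> {x. snd x < k}" for k
  proof -
    have "{x. snd x < k} = {x \<in> topspace \<tau>. ext_bicyclic_mult x (k, k) \<noteq> x}"
      by (auto simp: top split: if_splits)
    then show ?thesis
      using openin_noteq_continuous_maps[OF haus contR contI] by simp
  qed
  let ?A = "{x. fst x < a + 1}" and ?B = "{x. snd x < b + 1}"
  \<comment> \<open>On \<open>?A\<close> the product with \<open>(a, a)\<close> is
    \<open>(a, d + a - c)\<close> for \<open>x = (c, d)\<close>, so \<open>?C\<close> demands d - c
    \<le> b - a. Symmetrically, on \<open>?B\<close> the set \<open>?D\<close> demands the reverse
    inequality, which leaves the diagonal through \<open>(a, b)\<close>.\<close>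
  let ?C = "{x \<in> topspace \<tau>. ext_bicyclic_mult (a, a) x \<in> ?B}"
  let ?D = "{x \<in> topspace \<tau>. ext_bicyclic_mult x (b, b) \<in> ?A}"
  let ?E = "{x \<in> topspace \<tau>. ext_bicyclic_mult (a - 1, a - 1) x \<in> topspace \<tau> - {(a - 1, b - 1)}}"
  have "openin \<tau> (topspace \<tau> - {(a - 1, b - 1)})"
    using closedin_Hausdorff_singleton[OF haus] top by blast
  then have "openin \<tau> (?A \<inter> ?B \<inter> ?C \<inter> ?D \<inter> ?E)"
    by (intro openin_Int fst_less snd_less openin_continuous_map_preimage[OF contL]
        openin_continuous_map_preimage[OF contR])
  moreover have "?A \<inter> ?B \<inter> ?C \<inter> ?D \<inter> ?E = {(a, b)}" (is "?L = _")
  proof (intro equalityI subsetI)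
    fix p assume p: "p \<in> ?L"
    obtain c d where cd: "p = (c, d)"
      by force
    have "c \<le> a" "d \<le> b"
      using p cd by auto
    moreover from this have "d + a - c \<le> b" "c + b - d \<le> a"
      using p cd by (simp_all split: if_splits)
    ultimately have "d = c + (b - a)" "c \<le> a"
      by simp_all
    \<comment> \<open>If c \<le> a - 1, the product in \<open>?E\<close> is
      \<open>(a - 1, d + a - 1 - c)\<close>. On the diagonal this is the excluded point
      \<open>(a - 1, b - 1)\<close>.\<close>
    moreover have "\<not> c < a"
      using p cd calculation by (simp split: if_splits)
    ultimately show "p \<in> {(a, b)}"
      using cd by simp
  qed (simp add: top)
  ultimately show ?thesis
    by simp
qed

lemma ext_bicyclic_discrete:
  assumes "topspace \<tau> = UNIV" "semitopological_semigroup \<tau> ext_bicyclic_mult"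
  shows "\<tau> = discrete_topology UNIV"
  using ext_bicyclic_openin_singleton[OF assms] assms(1)
  by (metis discrete_topology_unique surj_pair)

text \<open>Injectivity of \<open>h\<close> transfers the Hausdorff property, and the homomorphism
  law transfers continuity of translations.\<close>

lemma semitopological_semigroup_pullback:
  assumes semi: "semitopological_semigroup T m"
    and semi_n: "semigroup_on UNIV n"
    and h: "range h \<subseteq> topspace T" "inj h"
    and hom: "\<And>x y. h (n x y) = m (h x) (h y)"
  shows "semitopological_semigroup (pullback_topology UNIV h T) n"
proof -
  let ?P = "pullback_topology UNIV h T"
  have top: "topspace ?P = UNIV"
    using h(1) by (auto simp: topspace_pullback_topology)
  have cont: "continuous_map ?P T h"
    using continuous_map_pullback[OF continuous_map_id, of UNIV h T] by simp
  have "Hausdorff_space ?P"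
    using Hausdorff_space_injective_preimage[OF semitopological_semigroupD(1)[OF semi] cont]
      h(2) top by simp
  \<comment> \<open>Universal property of the initial topology: continuity into \<open>?P\<close> is
    tested after composing with \<open>h\<close>.\<close>
  moreover have "continuous_map ?P ?P f" if "continuous_map ?P T (h \<circ> f)" for f
    using that by (intro continuous_map_pullback') auto
  \<comment> \<open>By \<open>hom\<close>, each composite is \<open>h\<close> followed by a
    translation of \<open>T\<close> by \<open>h x\<close>.\<close>
  moreover have "continuous_map ?P T (h \<circ> n x)" "continuous_map ?P T (h \<circ> (\<lambda>y. n y x))" for x
    using continuous_map_compose[OF cont semitopological_semigroupD(2)[OF semi, of "h x"]]
      continuous_map_compose[OF cont semitopological_semigroupD(3)[OF semi, of "h x"]] h(1)
    by (auto simp: o_def hom)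
  ultimately show ?thesis
    using semi_n by (simp add: semitopological_semigroup_def top)
qed

theorem theorem3p1:
  shows "(\<forall>\<tau> :: (int \<times> int) topology.
            topspace \<tau> = UNIV \<and> semitopological_semigroup \<tau> ext_bicyclic_mult \<longrightarrow>
            \<tau> = discrete_topology UNIV) \<and>
         (\<forall>(T :: 'a topology) (m :: 'a \<Rightarrow> 'a \<Rightarrow> 'a) (h :: int \<times> int \<Rightarrow> 'a).
            semitopological_semigroup T m \<and> ext_bicyclic_embedding (topspace T) m h \<longrightarrow>
            subtopology T (range h) = discrete_topology (range h))"
proof (intro conjI allI impI)
  fix \<tau> :: "(int \<times> int) topology"
  assume "topspace \<tau> = UNIV \<and> semitopological_semigroup \<tau> ext_bicyclic_mult"
  then show "\<tau> = discrete_topology UNIV"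
    using ext_bicyclic_discrete by blast
next
  fix T :: "'a topology" and m and h :: "int \<times> int \<Rightarrow> 'a"
  assume *: "semitopological_semigroup T m \<and> ext_bicyclic_embedding (topspace T) m h"
  then have h: "range h \<subseteq> topspace T" "inj h"
    and hom: "\<And>x y. h (ext_bicyclic_mult x y) = m (h x) (h y)"
    by (auto simp: ext_bicyclic_embedding_def)
  let ?P = "pullback_topology UNIV h T"
  have "topspace ?P = UNIV"
    using h(1) by (auto simp: topspace_pullback_topology)
  moreover have "semitopological_semigroup ?P ext_bicyclic_mult"
    using * semigroup_on_ext_bicyclic h hom by (blast intro: semitopological_semigroup_pullback)
  ultimately have P: "?P = discrete_topology UNIV"
    by (rule ext_bicyclic_discrete)
  have "openin (subtopology T (range h)) {h p}" for p
  proof -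
    have "openin ?P {p}"
      by (simp add: P)
    \<comment> \<open>Since \<open>U\<close> pulls back to \<open>{p}\<close> alone, it meets
      \<open>range h\<close> only in \<open>h p\<close>.\<close>
    then obtain U where "openin T U" "{p} = h -` U"
      by (auto simp: openin_pullback_topology)
    then have "openin T U \<and> {h p} = U \<inter> range h"
      by auto
    then show ?thesis
      by (auto simp: openin_subtopology)
  qed
  moreover have "topspace (subtopology T (range h)) = range h"
    using h(1) by auto
  ultimately show "subtopology T (range h) = discrete_topology (range h)"
    by (metis discrete_topology_unique imageE)
qed

end
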